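(* Let $N\ge1$, let $\Omega\subset\mathbb{H}$ be an axially symmetric domain (not necessarily intersecting the real line) and let $f:\Omega\to\mathbb{H}$ be a slice polyanalytic function of order $N$. Assume that there exist $J,K\in\mathbb{S}$ with $J\neq K$ and two subdomains $U_J$, $U_K$ of $\Omega_J^+$ and $\Omega_K^+$ respectively, where $\Omega_J^+:=\Omega\cap\mathbb{C}_J^+$ and $\Omega_K^+:=\Omega\cap\mathbb{C}_K^+$. If $f=0$ on $U_J$ and on $U_K$, then $f=0$ everywhere in $\Omega$.
   Context: $\mathbb{H}$ denotes the quaternions, $\mathbb{S}=\{q\in\mathbb{H}: q^2=-1\}$, and for $I\in\mathbb{S}$, $\mathbb{C}_I=\mathbb{R}+\mathbb{R}I$ and $\mathbb{C}_I^+=\{x+yI: x,y\in\mathbb{R},\ y\ge0\}$. A domain (subdomain) is a nonempty connected open set (subset). An open set $\Omega$ is axially symmetric if $x+Iy\in\Omega$ implies $x+Jy\in\Omega$ for all $J\in\mathbb{S}$. Slice polyanalytic functions: let $\Omega$ be an axially symmetric open set and $\mathcal{U}=\{(x,y)\in\mathbb{R}^2: x+Iy\in\Omega \text{ for all } I\in\mathbb{S}\}$. A function $f:\Omega\to\mathbb{H}$ is a (left) slice function if $f(x+Iy)=\alpha(x,y)+I\beta(x,y)$ for all $x+Iy\in\Omega$, $I\in\mathbb{S}$, where $\alpha,\beta:\mathcal{U}\to\mathbb{H}$ do not depend on $I$ and satisfy $\alpha(x,-y)=\alpha(x,y)$, $\beta(x,-y)=-\beta(x,y)$. If moreover $\alpha,\beta$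 are of class $\mathcal{C}^N$ and $\frac{1}{2^N}(\partial_x+I\partial_y)^N(\alpha(x,y)+I\beta(x,y))=0$ for all $I\in\mathbb{S}$, then $f$ is called (left) slice polyanalytic of order $N$. *)

theory Defs
  imports "HOL-Analysis.Analysis"
begin

section \<open>The quaternions\<close>

datatype quaternion =
  Quaternion (qre: real) (qim1: real) (qim2: real) (qim3: real)

lemma quaternion_eq_iff:
  "p = q \<longleftrightarrow> qre p = qre q \<and> qim1 p = qim1 q \<and> qim2 p = qim2 q \<and> qim3 p = qim3 q"
  by (cases p; cases q) simp

instantiation quaternion :: real_vector
begin

definition "0 = Quaternion 0 0 0 0"
definition "p + q = Quaternion (qre p + qre q) (qim1 p + qim1 q) (qim2 p + qim2 q) (qim3 p + qim3 q)"
definition "- p = Quaternion (- qre p) (- qim1 p) (- qim2 p) (- qim3 p)"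
definition "p - q = Quaternion (qre p - qre q) (qim1 p - qim1 q) (qim2 p - qim2 q) (qim3 p - qim3 q)"
definition "r *\<^sub>R q = Quaternion (r * qre q) (r * qim1 q) (r * qim2 q) (r * qim3 q)"

lemma quaternion_linear_sel [simp]:
  "qre 0 = 0" "qim1 0 = 0" "qim2 0 = 0" "qim3 0 = 0"
  "qre (p + q) = qre p + qre q" "qim1 (p + q) = qim1 p + qim1 q"
  "qim2 (p + q) = qim2 p + qim2 q" "qim3 (p + q) = qim3 p + qim3 q"
  "qre (- p) = - qre p" "qim1 (- p) = - qim1 p" "qim2 (- p) = - qim2 p" "qim3 (- p) = - qim3 p"
  "qre (p - q) = qre p - qre q" "qim1 (p - q) = qim1 p - qim1 q"
  "qim2 (p - q) = qim2 p - qim2 q" "qim3 (p - q) = qim3 p - qim3 q"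
  "qre (r *\<^sub>R q) = r * qre q" "qim1 (r *\<^sub>R q) = r * qim1 q"
  "qim2 (r *\<^sub>R q) = r * qim2 q" "qim3 (r *\<^sub>R q) = r * qim3 q"
  by (simp_all add: zero_quaternion_def plus_quaternion_def uminus_quaternion_def
      minus_quaternion_def scaleR_quaternion_def)

instance
  by standard (simp_all add: quaternion_eq_iff algebra_simps)

end

instantiation quaternion :: real_algebra_1
begin

definition "1 = Quaternion 1 0 0 0"

definition "p * q = Quaternion
  (qre p * qre q - qim1 p * qim1 q - qim2 p * qim2 q - qim3 p * qim3 q)
  (qre p * qim1 q + qim1 p * qre q + qim2 p * qim3 q - qim3 p * qim2 q)
  (qre p * qim2 q - qim1 p * qim3 q + qim2 p * qre q + qim3 p * qim1 q)
  (qre p * qim3 q + qim1 p * qim2 q - qim2 p * qim1 q + qim3 p * qre q)"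

lemma quaternion_mult_sel [simp]:
  "qre 1 = 1" "qim1 1 = 0" "qim2 1 = 0" "qim3 1 = 0"
  "qre (p * q) = qre p * qre q - qim1 p * qim1 q - qim2 p * qim2 q - qim3 p * qim3 q"
  "qim1 (p * q) = qre p * qim1 q + qim1 p * qre q + qim2 p * qim3 q - qim3 p * qim2 q"
  "qim2 (p * q) = qre p * qim2 q - qim1 p * qim3 q + qim2 p * qre q + qim3 p * qim1 q"
  "qim3 (p * q) = qre p * qim3 q + qim1 p * qim2 q - qim2 p * qim1 q + qim3 p * qre q"
  by (simp_all add: one_quaternion_def times_quaternion_def)

instance
  by standard (simp_all add: quaternion_eq_iff algebra_simps)

end

instantiation quaternion :: real_inner
begin

definition "inner p q = qre p * qre q + qim1 p * qim1 q + qim2 p * qim2 q + qim3 p * qim3 q"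

definition norm_quaternion_def: "norm (q :: quaternion) = sqrt (inner q q)"
definition "sgn (q :: quaternion) = inverse (norm q) *\<^sub>R q"
definition "dist (p :: quaternion) q = norm (p - q)"
definition "(uniformity :: (quaternion \<times> quaternion) filter) =
  (INF e\<in>{0 <..}. principal {(p, q). dist p q < e})"
definition "open (U :: quaternion set) \<longleftrightarrow>
  (\<forall>p\<in>U. eventually (\<lambda>(p', q). p' = p \<longrightarrow> q \<in> U) uniformity)"

instance
proof
  fix p q r :: quaternion and a :: real
  show "inner p q = inner q p"
    by (simp add: inner_quaternion_def mult.commute)
  show "inner (p + q) r = inner p r + inner q r"
    by (simp add: inner_quaternion_def algebra_simps)
  show "inner (a *\<^sub>R p) q = a * inner p q"
    by (simp add: inner_quaternion_def algebra_simps)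
  show "0 \<le> inner p p"
    by (simp add: inner_quaternion_def)
  show "inner p p = 0 \<longleftrightarrow> p = 0"
    by (auto simp: inner_quaternion_def quaternion_eq_iff add_nonneg_eq_0_iff)
qed (fact norm_quaternion_def sgn_quaternion_def dist_quaternion_def
    uniformity_quaternion_def open_quaternion_def)+

end

instantiation quaternion :: real_normed_div_algebra
begin

definition "inverse q = inverse (inner q q) *\<^sub>R Quaternion (qre q) (- qim1 q) (- qim2 q) (- qim3 q)"
definition "p div (q :: quaternion) = p * inverse q"

instance
proof
  fix p q :: quaternion
  let ?c = "Quaternion (qre q) (- qim1 q) (- qim2 q) (- qim3 q)"
  have left: "?c * q = inner q q *\<^sub>R 1" and right: "q * ?c = inner q q *\<^sub>R 1"
    by (simp_all add: quaternion_eq_iff inner_quaternion_def algebra_simps)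
  show "inverse q * q = 1" if "q \<noteq> 0"
    using that by (simp add: inverse_quaternion_def left)
  show "q * inverse q = 1" if "q \<noteq> 0"
    using that by (simp add: inverse_quaternion_def right)
  have "inner (p * q) (p * q) = inner p p * inner q q"
    unfolding inner_quaternion_def quaternion_mult_sel by algebra
  then show "norm (p * q) = norm p * norm q"
    by (simp add: norm_quaternion_def real_sqrt_mult)
  show "p div q = p * inverse q"
    by (fact divide_quaternion_def)
  show "inverse (0 :: quaternion) = 0"
    by (simp add: inverse_quaternion_def)
qed

end

instantiation quaternion :: euclidean_space
begin

definition "Basis =
  {Quaternion 1 0 0 0, Quaternion 0 1 0 0, Quaternion 0 0 1 0, Quaternion 0 0 0 1}"

instance
proof
  show "(Basis :: quaternion set) \<noteq> {}" "finite (Basis :: quaternion set)"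
    by (simp_all add: Basis_quaternion_def)
  have "\<forall>u\<in>Basis :: quaternion set. \<forall>v\<in>Basis. inner u v = (if u = v then 1 else 0)"
    unfolding Basis_quaternion_def inner_quaternion_def by simp
  then show "inner u v = (if u = v then 1 else 0)"
    if "u \<in> Basis" "v \<in> Basis" for u v :: quaternion
    using that by blast
  show "(\<forall>u\<in>Basis. inner q u = 0) \<longleftrightarrow> q = 0" for q :: quaternion
    unfolding Basis_quaternion_def inner_quaternion_def by (simp add: quaternion_eq_iff [of q 0])
qed

end


section \<open>Slices and axially symmetric sets\<close>

definition imag_units :: "quaternion set" where
  "imag_units = {q. q\<^sup>2 = - 1}"

definition half_slice :: "quaternion \<Rightarrow> quaternion set" where
  "half_slice I = {of_real x + I * of_real y | x y. y \<ge> 0}"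

definition axially_symmetric :: "quaternion set \<Rightarrow> bool" where
  "axially_symmetric \<Omega> \<longleftrightarrow>
     (\<forall>x y. \<forall>I\<in>imag_units. \<forall>J\<in>imag_units.
        of_real x + I * of_real y \<in> \<Omega> \<longrightarrow> of_real x + J * of_real y \<in> \<Omega>)"

text \<open>The topology is relative to \<open>X\<close>, since \<open>X\<close> will be a subset of a closed half-plane and
  hence never open in the quaternions unless it is empty.\<close>

definition subdomain :: "'a::topological_space set \<Rightarrow> 'a set \<Rightarrow> bool" where
  "subdomain X U \<longleftrightarrow> U \<noteq> {} \<and> connected U \<and> openin (top_of_set X) U"

definition slice_coords :: "quaternion set \<Rightarrow> (real \<times> real) set" where
  "slice_coords \<Omega> = {(x, y). \<forall>I\<in>imag_units. of_real x + I * of_real y \<in> \<Omega>}"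


section \<open>Partial derivatives and functions of class \<open>C\<^sup>N\<close>\<close>

definition partial_x :: "(real \<times> real \<Rightarrow> 'a::real_normed_vector) \<Rightarrow> real \<times> real \<Rightarrow> 'a" where
  "partial_x g = (\<lambda>(x, y). vector_derivative (\<lambda>t. g (t, y)) (at x))"

definition partial_y :: "(real \<times> real \<Rightarrow> 'a::real_normed_vector) \<Rightarrow> real \<times> real \<Rightarrow> 'a" where
  "partial_y g = (\<lambda>(x, y). vector_derivative (\<lambda>t. g (x, t)) (at y))"

text \<open>All partial derivatives up to order \<open>N\<close> exist and are continuous on \<open>U\<close>. This is meant for
  open \<open>U\<close>: then the values of \<open>g\<close> outside \<open>U\<close> do not matter.\<close>

primrec class_C :: "nat \<Rightarrow> (real \<times> real) set \<Rightarrow> (real \<times> real \<Rightarrow> 'a::real_normed_vector) \<Rightarrow> bool"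
where
  "class_C 0 U g \<longleftrightarrow> continuous_on U g"
| "class_C (Suc n) U g \<longleftrightarrow>
     continuous_on U g \<and>
     (\<forall>(x, y)\<in>U. (\<lambda>t. g (t, y)) differentiable (at x) \<and> (\<lambda>t. g (x, t)) differentiable (at y)) \<and>
     class_C n U (partial_x g) \<and> class_C n U (partial_y g)"


section \<open>Slice polyanalytic functions\<close>

text \<open>\<open>\<alpha>\<close> and \<open>\<beta>\<close> are total functions of which only the values on \<^term>\<open>slice_coords \<Omega>\<close> matter. That
  set is invariant under \<open>(x, y) \<mapsto> (x, - y)\<close>, as \<^const>\<open>imag_units\<close> is closed under negation.\<close>

definition slice_components ::
  "quaternion set \<Rightarrow> (quaternion \<Rightarrow> quaternion) \<Rightarrow>
   (real \<times> real \<Rightarrow> quaternion) \<Rightarrow> (real \<times> real \<Rightarrow> quaternion) \<Rightarrow> bool" where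
  "slice_components \<Omega> f \<alpha> \<beta> \<longleftrightarrow>
     (\<forall>x y. \<forall>I\<in>imag_units. of_real x + I * of_real y \<in> \<Omega> \<longrightarrow>
        f (of_real x + I * of_real y) = \<alpha> (x, y) + I * \<beta> (x, y)) \<and>
     (\<forall>(x, y)\<in>slice_coords \<Omega>. \<alpha> (x, - y) = \<alpha> (x, y) \<and> \<beta> (x, - y) = - \<beta> (x, y))"

definition slice_dbar ::
  "quaternion \<Rightarrow> (real \<times> real \<Rightarrow> quaternion) \<Rightarrow> real \<times> real \<Rightarrow> quaternion" where
  "slice_dbar I g = (\<lambda>p. partial_x g p + I * partial_y g p)"

text \<open>On an axially symmetric \<open>\<Omega>\<close> the values of \<open>\<alpha>\<close> and \<open>\<beta>\<close> on \<^term>\<open>slice_coords \<Omega>\<close> are determined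
  by \<open>f\<close>, so the existential quantifier speaks about the components of the slice function \<open>f\<close>.\<close>

definition slice_polyanalytic ::
  "nat \<Rightarrow> quaternion set \<Rightarrow> (quaternion \<Rightarrow> quaternion) \<Rightarrow> bool" where
  "slice_polyanalytic N \<Omega> f \<longleftrightarrow>
     (\<exists>\<alpha> \<beta>. slice_components \<Omega> f \<alpha> \<beta> \<and>
        class_C N (slice_coords \<Omega>) \<alpha> \<and> class_C N (slice_coords \<Omega>) \<beta> \<and>
        (\<forall>I\<in>imag_units. \<forall>p\<in>slice_coords \<Omega>.
           (1 / 2 ^ N) *\<^sub>R (slice_dbar I ^^ N) (\<lambda>q. \<alpha> q + I * \<beta> q) p = 0))"

end

theory Submission
  imports Defs "HOL-Complex_Analysis.Complex_Analysis"
begin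

text \<open>
  Write \<open>X\<close> for the set of coordinates \<open>(x, y)\<close> of \<open>\<Omega>\<close> and \<open>F\<^sub>I = \<alpha> + I \<beta>\<close> for the restriction of
  the slice function \<open>f\<close> to the slice of \<open>I\<close>. The theorem reduces to an identity theorem in the
  plane: a function of class \<open>C\<^sup>N\<close> with \<open>(\<partial>\<^sub>x + J \<partial>\<^sub>y)\<^sup>N F = 0\<close> on a connected open set
  vanishes as soon as it vanishes on a nonempty open subset. Given this, \<open>F\<^sub>J\<close> and \<open>F\<^sub>K\<close> both vanish
  where \<open>y \<ge> 0\<close>, hence so does \<open>F\<^sub>J - F\<^sub>K = (J - K) \<beta>\<close>. As the quaternions form a division ring, \<open>\<beta> = 0\<close>, then
  \<open>\<alpha> = 0\<close>, and \<open>f\<close> vanishes on every slice.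

  The identity theorem (\<open>slice_dbar_power_identity\<close>) is an induction on \<open>N\<close>: the function
  \<open>(\<partial>\<^sub>x + J \<partial>\<^sub>y) F\<close> has order \<open>N - 1\<close> and still vanishes on the small open set, so it is zero
  everywhere, and \<open>F\<close> has order one. In order one, left multiplication by \<open>J\<close> turns the
  quaternions into a complex vector space for which \<open>F\<close> is holomorphic; complex linear functionals (\<open>slice_functional\<close>)
  reduce the claim to the identity theorem for holomorphic functions.

  Connectedness needs care, because \<open>X\<close> is disconnected when \<open>\<Omega>\<close> misses the real line. The
  half of \<open>X\<close> with \<open>y \<ge> 0\<close> is, however, a continuous image of \<open>\<Omega>\<close> under
  \<open>q \<mapsto> (Re q, \<bar>Im q\<bar>)\<close>, so it lies in a single component of \<open>X\<close>. It is this open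
  component to which the identity theorem is applied.
\<close>


section \<open>Calculus of partial derivatives\<close>

lemma eventually_horizontal_line:
  fixes U :: "(real \<times> real) set"
  assumes "open U" "(x, y) \<in> U"
  shows "eventually (\<lambda>t. (t, y) \<in> U) (nhds x)"
proof -
  have "open ((\<lambda>t. (t, y)) -` U)"
    by (intro open_vimage assms continuous_intros)
  then show ?thesis
    using assms(2) eventually_nhds_in_open by fastforce
qed

lemma eventually_vertical_line:
  fixes U :: "(real \<times> real) set"
  assumes "open U" "(x, y) \<in> U"
  shows "eventually (\<lambda>t. (x, t) \<in> U) (nhds y)"
proof -
  have "open ((\<lambda>t. (x, t)) -` U)"
    by (intro open_vimage assms continuous_intros)
  then show ?thesis
    using assms(2) eventually_nhds_in_open by fastforce
qed

lemma partial_x_cong: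
  assumes "open U" "\<And>p. p \<in> U \<Longrightarrow> f p = g p" "p \<in> U"
  shows "partial_x f p = partial_x g p"
proof (cases p)
  case (Pair x y)
  have "eventually (\<lambda>t. f (t, y) = g (t, y)) (nhds x)"
    using eventually_horizontal_line[of U x y] assms Pair by (auto elim: eventually_mono)
  then show ?thesis
    unfolding Pair partial_x_def by (auto intro!: vector_derivative_cong_eq)
qed

lemma partial_y_cong:
  assumes "open U" "\<And>p. p \<in> U \<Longrightarrow> f p = g p" "p \<in> U"
  shows "partial_y f p = partial_y g p"
proof (cases p)
  case (Pair x y)
  have "eventually (\<lambda>t. f (x, t) = g (x, t)) (nhds y)"
    using eventually_vertical_line[of U x y] assms Pair by (auto elim: eventually_mono)
  then show ?thesis
    unfolding Pair partial_y_def by (auto intro!: vector_derivative_cong_eq)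
qed

lemma class_C_subset:
  assumes "class_C n U g" "D \<subseteq> U"
  shows "class_C n D g"
  using assms by (induction n arbitrary: g) (auto intro: continuous_on_subset)

lemma class_C_continuous_on: "class_C n U g \<Longrightarrow> continuous_on U g"
  by (cases n) auto

lemma class_C_has_partial_x:
  assumes "class_C (Suc n) U g" "(x, y) \<in> U"
  shows "((\<lambda>t. g (t, y)) has_vector_derivative partial_x g (x, y)) (at x)"
  using assms by (auto simp: partial_x_def vector_derivative_works[symmetric])

lemma class_C_has_partial_y:
  assumes "class_C (Suc n) U g" "(x, y) \<in> U"
  shows "((\<lambda>t. g (x, t)) has_vector_derivative partial_y g (x, y)) (at y)"
  using assms by (auto simp: partial_y_def vector_derivative_works[symmetric])

lemma class_C_cong:
  assumes "open U" "\<And>p. p \<in> U \<Longrightarrow> f p = g p" "class_C n U f"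
  shows "class_C n U g"
  using assms(2,3)
proof (induction n arbitrary: f g)
  case 0
  then show ?case by (simp cong: continuous_on_cong_simp)
next
  case (Suc n)
  have "class_C n U (partial_x g)"
    by (rule Suc.IH[OF partial_x_cong[OF assms(1) Suc.prems(1)]]) (use Suc.prems(2) in auto)
  moreover have "class_C n U (partial_y g)"
    by (rule Suc.IH[OF partial_y_cong[OF assms(1) Suc.prems(1)]]) (use Suc.prems(2) in auto)
  moreover have "continuous_on U g"
    using Suc.prems continuous_on_cong[of U U f g] by simp
  moreover have "(\<lambda>t. g (t, y)) differentiable (at x)" if "(x, y) \<in> U" for x y
  proof -
    have "eventually (\<lambda>t. f (t, y) = g (t, y)) (nhds x)"
      using eventually_horizontal_line[OF assms(1) that] Suc.prems(1) by (auto elim: eventually_mono)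
    then have "((\<lambda>t. g (t, y)) has_vector_derivative partial_x f (x, y)) (at x)"
      using class_C_has_partial_x[OF Suc.prems(2) that]
        has_vector_derivative_cong_ev[where S = UNIV and x = x and f = "\<lambda>t. f (t, y)" and g = "\<lambda>t. g (t, y)"] Suc.prems(1)[OF that]
      by (auto elim: eventually_mono)
    then show ?thesis by (rule differentiableI_vector)
  qed
  moreover have "(\<lambda>t. g (x, t)) differentiable (at y)" if "(x, y) \<in> U" for x y
  proof -
    have "eventually (\<lambda>t. f (x, t) = g (x, t)) (nhds y)"
      using eventually_vertical_line[OF assms(1) that] Suc.prems(1) by (auto elim: eventually_mono)
    then have "((\<lambda>t. g (x, t)) has_vector_derivative partial_y f (x, y)) (at y)"
      using class_C_has_partial_y[OF Suc.prems(2) that]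
        has_vector_derivative_cong_ev[where S = UNIV and x = y and f = "\<lambda>t. f (x, t)" and g = "\<lambda>t. g (x, t)"] Suc.prems(1)[OF that]
      by (auto elim: eventually_mono)
    then show ?thesis by (rule differentiableI_vector)
  qed
  ultimately show ?case by auto
qed

text \<open>With \<open>L\<close> the left multiplication by \<open>I\<close>, this covers both \<open>\<alpha> + I \<beta>\<close> and
  \<open>\<partial>\<^sub>x F + I \<partial>\<^sub>y F\<close>.\<close>

lemma class_C_add_linear:
  assumes "open U" "bounded_linear L" "class_C n U f" "class_C n U g"
  shows "class_C n U (\<lambda>p. f p + L (g p))"
  using assms(3,4)
proof (induction n arbitrary: f g)
  case 0
  then show ?case
    by (auto intro!: continuous_intros bounded_linear.continuous_on[OF assms(2)])
next
  case (Suc n)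
  let ?h = "\<lambda>p. f p + L (g p)"
  have dx: "((\<lambda>t. ?h (t, y)) has_vector_derivative
      partial_x f (x, y) + L (partial_x g (x, y))) (at x)" if "(x, y) \<in> U" for x y
    by (intro has_vector_derivative_add bounded_linear.has_vector_derivative[OF assms(2)]
        class_C_has_partial_x[OF Suc.prems(1) that] class_C_has_partial_x[OF Suc.prems(2) that])
  have dy: "((\<lambda>t. ?h (x, t)) has_vector_derivative
      partial_y f (x, y) + L (partial_y g (x, y))) (at y)" if "(x, y) \<in> U" for x y
    by (intro has_vector_derivative_add bounded_linear.has_vector_derivative[OF assms(2)]
        class_C_has_partial_y[OF Suc.prems(1) that] class_C_has_partial_y[OF Suc.prems(2) that])
  have "class_C n U (partial_x ?h)"
  proof (rule class_C_cong[OF assms(1)])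
    show "class_C n U (\<lambda>p. partial_x f p + L (partial_x g p))"
      using Suc by auto
    show "partial_x f p + L (partial_x g p) = partial_x ?h p" if "p \<in> U" for p
      using dx[of "fst p" "snd p"] that
      by (auto simp: partial_x_def split_beta dest: vector_derivative_at)
  qed
  moreover have "class_C n U (partial_y ?h)"
  proof (rule class_C_cong[OF assms(1)])
    show "class_C n U (\<lambda>p. partial_y f p + L (partial_y g p))"
      using Suc by auto
    show "partial_y f p + L (partial_y g p) = partial_y ?h p" if "p \<in> U" for p
      using dy[of "fst p" "snd p"] that
      by (auto simp: partial_y_def split_beta dest: vector_derivative_at)
  qed
  moreover have "continuous_on U ?h"
    using Suc.prems
    by (auto intro!: continuous_intros bounded_linear.continuous_on[OF assms(2)])
  moreover have "(\<lambda>t. ?h (t, y)) differentiable (at x)" "(\<lambda>t. ?h (x, t)) differentiable (at y)"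
    if "(x, y) \<in> U" for x y
    using dx[OF that] dy[OF that] by (blast intro: differentiableI_vector)+
  ultimately show ?case by auto
qed

text \<open>Existence of partial derivatives does not give differentiability; their continuity does.
  The point is first enclosed in a box inside \<open>U\<close> whose vertical side is convex, so that the mean
  value inequality applies to vertical increments.\<close>

lemma class_C_1_has_derivative:
  fixes g :: "real \<times> real \<Rightarrow> 'a::banach"
  assumes "open U" "class_C 1 U g" "(x, y) \<in> U"
  shows "(g has_derivative (\<lambda>(s, t). s *\<^sub>R partial_x g (x, y) + t *\<^sub>R partial_y g (x, y))) (at (x, y))"
proof -
  obtain A B where AB: "open A" "open B" "(x, y) \<in> A \<times> B" "A \<times> B \<subseteq> U"
    using open_prod_elim[OF assms(1,3)] by metis
  obtain e where e: "e > 0" "ball y e \<subseteq> B"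
    using AB openE by blast
  let ?Y = "ball y e"
  have C: "class_C (Suc 0) U g" using assms(2) by simp
  have sub: "A \<times> ?Y \<subseteq> U" using AB e by blast
  have xA: "x \<in> A" and yB: "y \<in> ?Y" using AB e by auto
  let ?f = "\<lambda>s t. g (s, t)"
  have "((\<lambda>(s, t). ?f s t) has_derivative
     (\<lambda>(tx, ty). tx *\<^sub>R partial_x g (x, y) + blinfun_apply (blinfun_scaleR_left (partial_y g (x, y))) ty))
     (at (x, y) within A \<times> ?Y)"
  proof (rule has_derivative_partialsI[where f = ?f and X = A and Y = ?Y and
      fx = "\<lambda>tx. tx *\<^sub>R partial_x g (x, y)" and fy = "\<lambda>s t. blinfun_scaleR_left (partial_y g (s, t))"])
    show "((\<lambda>s. g (s, y)) has_derivative (\<lambda>tx. tx *\<^sub>R partial_x g (x, y))) (at x within A)"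
      using class_C_has_partial_x[OF C assms(3)]
      by (simp add: has_vector_derivative_def has_derivative_at_withinI)
    show "((\<lambda>t. g (s, t)) has_derivative blinfun_apply (blinfun_scaleR_left (partial_y g (s, t))))
        (at t within ?Y)" if "s \<in> A" "t \<in> ?Y" for s t
    proof (rule has_derivative_at_withinI)
      have "(s, t) \<in> U" using that sub by blast
      from class_C_has_partial_y[OF C this]
      show "((\<lambda>t. g (s, t)) has_derivative blinfun_apply (blinfun_scaleR_left (partial_y g (s, t)))) (at t)"
        by (simp add: has_vector_derivative_def)
    qed
    have "continuous_on U (partial_y g)" using C by simp
    then have "((\<lambda>(s, t). partial_y g (s, t)) \<longlongrightarrow> partial_y g (x, y)) (at (x, y) within A \<times> ?Y)"
      using assms(3) sub unfolding continuous_on_def by (auto intro: tendsto_within_subset)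
    then have "((\<lambda>p. blinfun_scaleR_left (partial_y g p)) \<longlongrightarrow> blinfun_scaleR_left (partial_y g (x, y)))
        (at (x, y) within A \<times> ?Y)"
      by (intro bounded_linear.tendsto[OF bounded_linear_blinfun_scaleR_left]) (simp add: split_beta)
    then have "continuous (at (x, y) within A \<times> ?Y) (\<lambda>p. blinfun_scaleR_left (partial_y g p))"
      by (simp only: continuous_within)
    moreover have "(\<lambda>p. blinfun_scaleR_left (partial_y g p)) =
        (\<lambda>(s, t). blinfun_scaleR_left (partial_y g (s, t)))"
      by auto
    ultimately show "continuous (at (x, y) within A \<times> ?Y)
        (\<lambda>(s, t). blinfun_scaleR_left (partial_y g (s, t)))"
      by (simp only:)
  qed (fact yB, rule convex_ball)
  moreover have "at (x, y) within A \<times> ?Y = at (x, y)"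
    using AB(1) xA yB by (intro at_within_open open_Times) auto
  ultimately show ?thesis
    by simp
qed


section \<open>The identity theorem for powers of the slice Cauchy-Riemann operator\<close>

lemma imag_units_square: "J \<in> imag_units \<Longrightarrow> J * J = - 1"
  by (simp add: imag_units_def power2_eq_square)

lemma imag_units_mult_cancel: "J \<in> imag_units \<Longrightarrow> J * (J * q) = - q"
  by (simp add: mult.assoc[symmetric] imag_units_square)

text \<open>For an imaginary unit \<open>J\<close>, the unique complex linear functional with real part \<open>q \<mapsto> q \<bullet> a\<close>, where
  multiplication by \<open>\<i>\<close> on the quaternions means left multiplication by \<open>J\<close>.\<close>

definition slice_functional :: "quaternion \<Rightarrow> quaternion \<Rightarrow> quaternion \<Rightarrow> complex" where
  "slice_functional J a q = Complex (q \<bullet> a) (- ((J * q) \<bullet> a))"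

lemma bounded_linear_slice_functional: "bounded_linear (slice_functional J a)"
proof -
  have "slice_functional J a =
      (\<lambda>q. of_real (q \<bullet> a) - \<i> * of_real ((J * q) \<bullet> a))"
    by (auto simp: slice_functional_def complex_eq_iff)
  moreover have "bounded_linear \<dots>"
    by (intro bounded_linear_sub bounded_linear_const_mult
        bounded_linear_compose[OF bounded_linear_of_real]
        bounded_linear_compose[OF bounded_linear_inner_left] bounded_linear_ident bounded_linear_mult_right)
  ultimately show ?thesis by simp
qed

lemma slice_functional_mult:
  assumes "J \<in> imag_units"
  shows "slice_functional J a (J * q) = \<i> * slice_functional J a q"
  by (simp add: slice_functional_def complex_eq_iff imag_units_mult_cancel[OF assms])

text \<open>Applying the functional to \<open>\<partial>\<^sub>x F + J \<partial>\<^sub>y F = 0\<close> gives the Cauchy-Riemann equations of its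
  composition with \<open>F\<close>, because \<open>J\<close> comes out as the factor \<open>\<i>\<close>.\<close>

lemma slice_functional_holomorphic:
  assumes J: "J \<in> imag_units" and D: "open D" and F: "class_C 1 D F"
    and dbar: "\<And>p. p \<in> D \<Longrightarrow> slice_dbar J F p = 0"
  shows "(\<lambda>z. slice_functional J a (F (Re z, Im z))) holomorphic_on {z. (Re z, Im z) \<in> D}"
proof -
  let ?L = "slice_functional J a"
  interpret L: bounded_linear ?L by (rule bounded_linear_slice_functional)
  have "((\<lambda>z. ?L (F (Re z, Im z))) has_field_derivative ?L (partial_x F (Re z, Im z))) (at z)"
    if z: "(Re z, Im z) \<in> D" for z
  proof -
    let ?X = "partial_x F (Re z, Im z)" and ?Y = "partial_y F (Re z, Im z)"
    have "?X = - (J * ?Y)"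
      using dbar[OF z] by (simp add: slice_dbar_def eq_neg_iff_add_eq_0)
    then have "J * ?X = ?Y"
      by (simp add: imag_units_mult_cancel[OF J])
    then have Y: "?L ?Y = \<i> * ?L ?X"
      using slice_functional_mult[OF J, of a ?X] by simp
    have "((\<lambda>z. (Re z, Im z)) has_derivative (\<lambda>w. (Re w, Im w))) (at z)"
      by (intro derivative_intros)
    from has_derivative_compose[OF this class_C_1_has_derivative[OF D F z]]
    have "((\<lambda>z. F (Re z, Im z)) has_derivative (\<lambda>w. Re w *\<^sub>R ?X + Im w *\<^sub>R ?Y)) (at z)"
      by simp
    then have "((\<lambda>z. ?L (F (Re z, Im z))) has_derivative (\<lambda>w. ?L (Re w *\<^sub>R ?X + Im w *\<^sub>R ?Y))) (at z)"
      by (rule L.has_derivative)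
    moreover have "?L (Re w *\<^sub>R ?X + Im w *\<^sub>R ?Y) = ?L ?X * w" for w
      by (simp add: L.add L.scaleR Y complex_eq_iff algebra_simps)
    ultimately show ?thesis
      by (simp add: has_field_derivative_def)
  qed
  then show ?thesis
    by (auto simp: holomorphic_on_def field_differentiable_def intro: has_field_derivative_at_within)
qed

text \<open>The functionals separate points: the one given by \<open>a = F p\<close> takes at \<open>F p\<close> a value with real
  part \<open>F p \<bullet> F p\<close>.\<close>

lemma slice_dbar_identity:
  assumes J: "J \<in> imag_units" and D: "open D" "connected D" and F: "class_C 1 D F"
    and dbar: "\<And>p. p \<in> D \<Longrightarrow> slice_dbar J F p = 0"
    and W: "open W" "W \<noteq> {}" "W \<subseteq> D" and zero: "\<And>p. p \<in> W \<Longrightarrow> F p = 0"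
    and p: "p \<in> D"
  shows "F p = 0"
proof -
  let ?E = "\<lambda>S. {z. (Re z, Im z) \<in> S}"
  have E: "?E S = (\<lambda>(x, y). Complex x y) ` S" for S
    by (force simp: image_iff complex_eq_iff)
  have opn: "open (?E S)" if "open S" for S
  proof -
    have "open ((\<lambda>z. (Re z, Im z)) -` S)"
      by (intro open_vimage that continuous_intros)
    then show ?thesis by (simp add: vimage_def)
  qed
  have con: "connected (?E D)"
    unfolding E by (intro connected_continuous_image D(2))
      (auto simp: split_beta Complex_eq intro!: continuous_intros)
  have "slice_functional J a (F p) = 0" for a
  proof -
    have "slice_functional J a (F (Re z, Im z)) = 0" if "z \<in> ?E D" for z
    proof (rule analytic_continuation_open[where f = "\<lambda>z. slice_functional J a (F (Re z, Im z))"
          and g = "\<lambda>_. 0", OF opn[OF W(1)] opn[OF D(1)]])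
      show "?E W \<noteq> {}" using W(2) unfolding E by simp
      show "?E W \<subseteq> ?E D" using W(3) by auto
      show "(\<lambda>z. slice_functional J a (F (Re z, Im z))) holomorphic_on ?E D"
        by (rule slice_functional_holomorphic[OF J D(1) F dbar])
    qed (use that con zero in \<open>auto simp: slice_functional_def complex_eq_iff\<close>)
    from this[of "Complex (fst p) (snd p)"] show ?thesis using p by simp
  qed
  from this[of "F p"] show ?thesis
    by (simp add: slice_functional_def complex_eq_iff)
qed

text \<open>The induction peels off the innermost factor \<open>\<partial>\<^sub>x + J \<partial>\<^sub>y\<close>, not the outermost one: the
  induction hypothesis then says that \<open>(\<partial>\<^sub>x + J \<partial>\<^sub>y) F\<close> vanishes on all of \<open>D\<close>, which is the
  holomorphy of \<open>F\<close>.\<close>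

lemma slice_dbar_power_identity:
  assumes J: "J \<in> imag_units" and D: "open D" "connected D" and F: "class_C N D F"
    and dbar: "\<And>p. p \<in> D \<Longrightarrow> (slice_dbar J ^^ N) F p = 0"
    and W: "open W" "W \<noteq> {}" "W \<subseteq> D" and zero: "\<And>p. p \<in> W \<Longrightarrow> F p = 0"
    and p: "p \<in> D"
  shows "F p = 0"
  using F dbar zero p
proof (induction N arbitrary: F p)
  case 0
  then show ?case by simp
next
  case (Suc N)
  have C: "class_C N D (slice_dbar J F)"
    unfolding slice_dbar_def
    by (rule class_C_add_linear[OF D(1) bounded_linear_mult_right]) (use Suc.prems(1) in auto)
  have "partial_x F q = 0" "partial_y F q = 0" if "q \<in> W" for q
    using partial_x_cong[OF W(1) _ that, of F "\<lambda>_. 0"] partial_y_cong[OF W(1) _ that, of F "\<lambda>_. 0"]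
      Suc.prems(3) by (simp_all add: partial_x_def partial_y_def split_beta)
  then have "slice_dbar J F q = 0" if "q \<in> W" for q
    using that by (simp add: slice_dbar_def)
  then have dbar0: "slice_dbar J F q = 0" if "q \<in> D" for q
    using Suc.IH[OF C] Suc.prems(2) that by (simp add: funpow_swap1)
  have "continuous_on D (partial_x F)" "continuous_on D (partial_y F)"
    using Suc.prems(1) by (auto intro: class_C_continuous_on)
  then have "class_C 1 D F"
    using Suc.prems(1) by simp
  from slice_dbar_identity[OF J D this dbar0 W Suc.prems(3,4)] show ?case .
qed


section \<open>Coordinates on an axially symmetric domain\<close>

definition half_plane_coords :: "quaternion \<Rightarrow> real \<times> real" where
  "half_plane_coords q = (qre q, norm (q - of_real (qre q)))"

lemma quaternion_of_real_sel [simp]: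
  "qre (of_real x) = x" "qim1 (of_real x) = 0" "qim2 (of_real x) = 0" "qim3 (of_real x) = 0"
  by (simp_all add: of_real_def)

lemma continuous_half_plane_coords: "continuous_on S half_plane_coords"
proof -
  have eq: "half_plane_coords = (\<lambda>q. (q \<bullet> 1, norm (q - of_real (q \<bullet> 1))))"
    by (simp add: half_plane_coords_def inner_quaternion_def fun_eq_iff)
  show ?thesis
    unfolding eq by (intro continuous_intros)
qed

lemma imag_units_iff: "J \<in> imag_units \<longleftrightarrow> qre J = 0 \<and> norm J = 1"
proof
  assume J: "J \<in> imag_units"
  then have sq: "J * J = - 1" by (rule imag_units_square)
  then have "norm J ^ 2 = 1"
    by (metis norm_minus_cancel norm_mult norm_one power2_eq_square)
  then have n: "norm J = 1"
    using power2_eq_1_iff[of "norm J"] norm_ge_zero[of J] by auto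
  have "qre (J * J) = - 1" using sq by simp
  moreover have "qre J * qre J + qim1 J * qim1 J + qim2 J * qim2 J + qim3 J * qim3 J = 1"
    using n by (simp add: norm_quaternion_def inner_quaternion_def)
  ultimately have "qre J * qre J = 0" unfolding quaternion_mult_sel by argo
  then show "qre J = 0 \<and> norm J = 1" using n by simp
next
  assume "qre J = 0 \<and> norm J = 1"
  then have "qre J = 0" "qim1 J * qim1 J + qim2 J * qim2 J + qim3 J * qim3 J = 1"
    by (auto simp: norm_quaternion_def inner_quaternion_def)
  then show "J \<in> imag_units"
    by (simp add: imag_units_def power2_eq_square quaternion_eq_iff)
qed

lemma half_plane_coords_slice:
  assumes "J \<in> imag_units" "y \<ge> 0"
  shows "half_plane_coords (of_real x + J * of_real y) = (x, y)"
proof -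
  have "qre (of_real x + J * of_real y) = x"
    using assms by (simp add: imag_units_iff)
  then show ?thesis
    using assms by (simp add: half_plane_coords_def norm_mult imag_units_iff)
qed

text \<open>A real \<open>q\<close> lies on every slice, and any imaginary unit serves; otherwise the unit is the
  normalised imaginary part of \<open>q\<close>.\<close>

lemma quaternion_slice_form:
  obtains I x y where "I \<in> imag_units" "q = of_real x + I * of_real y" "half_plane_coords q = (x, y)"
proof -
  let ?v = "q - of_real (qre q)"
  define I where "I = (if ?v = 0 then Quaternion 0 1 0 0 else ?v /\<^sub>R norm ?v)"
  have "norm (Quaternion 0 1 0 0) = 1"
    by (simp add: norm_quaternion_def inner_quaternion_def)
  then have "I \<in> imag_units"
    by (simp add: I_def imag_units_iff)
  moreover have "q = of_real (qre q) + I * of_real (norm ?v)"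
    by (auto simp: I_def of_real_def)
  ultimately show thesis
    by (rule that) (rule half_plane_coords_def)
qed

lemma slice_coords_iff:
  assumes "axially_symmetric \<Omega>" "J \<in> imag_units"
  shows "(x, y) \<in> slice_coords \<Omega> \<longleftrightarrow> of_real x + J * of_real y \<in> \<Omega>"
  using assms unfolding axially_symmetric_def slice_coords_def by blast

lemma open_slice_coords_vimage:
  assumes "open T"
  shows "open {p. of_real (fst p) + J * of_real (snd p) \<in> (T :: quaternion set)}"
proof -
  have "open ((\<lambda>p. of_real (fst p) + J * of_real (snd p)) -` T)"
    by (intro open_vimage assms continuous_intros)
  then show ?thesis by (simp add: vimage_def)
qed

lemma open_slice_coords:
  assumes "open \<Omega>" "axially_symmetric \<Omega>" "J \<in> imag_units"
  shows "open (slice_coords \<Omega>)"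
proof -
  have "slice_coords \<Omega> = {p. of_real (fst p) + J * of_real (snd p) \<in> \<Omega>}"
    using slice_coords_iff[OF assms(2,3)] by auto
  then show ?thesis
    using open_slice_coords_vimage[OF assms(1)] by simp
qed

lemma half_plane_coords_image_subset:
  assumes "axially_symmetric \<Omega>"
  shows "half_plane_coords ` \<Omega> \<subseteq> slice_coords \<Omega>"
proof
  fix p assume "p \<in> half_plane_coords ` \<Omega>"
  then obtain q where q: "q \<in> \<Omega>" "p = half_plane_coords q" by blast
  obtain I x y where "I \<in> imag_units" "q = of_real x + I * of_real y" "half_plane_coords q = (x, y)"
    by (rule quaternion_slice_form)
  then show "p \<in> slice_coords \<Omega>"
    using q slice_coords_iff[OF assms] by simp
qed

text \<open>The subdomain \<open>V\<close> may contain points of the real line, the edge of the half-plane, where it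
  is not a neighbourhood in the slice. Moving up by a small positive amount reaches \<open>y > 0\<close>.\<close>

lemma subdomain_half_slice_open_coords:
  assumes ax: "axially_symmetric \<Omega>" and J: "J \<in> imag_units"
    and V: "subdomain (\<Omega> \<inter> half_slice J) V"
    and D: "open D" "half_plane_coords ` \<Omega> \<subseteq> D" "D \<subseteq> slice_coords \<Omega>"
  obtains W where "open W" "W \<noteq> {}" "W \<subseteq> D"
    "\<And>x y. (x, y) \<in> W \<Longrightarrow> of_real x + J * of_real y \<in> V"
proof -
  obtain T where T: "open T" "V = \<Omega> \<inter> half_slice J \<inter> T" and "V \<noteq> {}"
    using V by (auto simp: subdomain_def openin_open)
  then obtain x y where xy: "y \<ge> 0" "of_real x + J * of_real y \<in> V"
    by (auto simp: half_slice_def)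
  let ?A = "{p. of_real (fst p) + J * of_real (snd p) \<in> T} \<inter> D"
  let ?W = "?A \<inter> {p. snd p > 0}"
  have "(x, y) \<in> D"
    using xy(2) T(2) D(2) half_plane_coords_slice[OF J xy(1)]
    by (metis IntD1 image_subset_iff)
  then have A: "open ?A" "(x, y) \<in> ?A"
    using xy(2) T D(1) by (auto intro: open_Int open_slice_coords_vimage)
  then obtain e where e: "e > 0" "ball (x, y) e \<subseteq> ?A"
    using openE by blast
  have "(x, y + e / 2) \<in> ball (x, y) e"
    using e(1) by (simp add: dist_Pair_Pair dist_real_def)
  then have "(x, y + e / 2) \<in> ?W"
    using e xy(1) by auto
  moreover have "open ?W"
    by (intro open_Int A(1) open_Collect_less continuous_intros)
  moreover have "of_real s + J * of_real t \<in> V" if "(s, t) \<in> ?W" for s t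
    using that T(2) D(3) slice_coords_iff[OF ax J, of s t]
    unfolding half_slice_def using less_imp_le[of 0 t] by fastforce
  ultimately show thesis
    using that[of ?W] by blast
qed

text \<open>On the zero set \<open>V\<close> only \<open>f\<close> on the slice of \<open>J\<close> is known, so this controls just the
  combination \<open>\<alpha> + J \<beta>\<close>; a second unit is needed to separate \<open>\<alpha>\<close> from \<open>\<beta>\<close>.\<close>

lemma slice_polyanalytic_slice_zero:
  assumes ax: "axially_symmetric \<Omega>" and J: "J \<in> imag_units"
    and D: "open D" "connected D" "half_plane_coords ` \<Omega> \<subseteq> D" "D \<subseteq> slice_coords \<Omega>"
    and comp: "slice_components \<Omega> f \<alpha> \<beta>"
    and \<alpha>: "class_C N (slice_coords \<Omega>) \<alpha>" and \<beta>: "class_C N (slice_coords \<Omega>) \<beta>"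
    and dbar: "\<forall>p\<in>slice_coords \<Omega>.
      (1 / 2 ^ N) *\<^sub>R (slice_dbar J ^^ N) (\<lambda>q. \<alpha> q + J * \<beta> q) p = 0"
    and V: "subdomain (\<Omega> \<inter> half_slice J) V" and zero: "\<forall>q\<in>V. f q = 0"
    and p: "p \<in> D"
  shows "\<alpha> p + J * \<beta> p = 0"
proof -
  obtain W where W: "open W" "W \<noteq> {}" "W \<subseteq> D"
    "\<And>x y. (x, y) \<in> W \<Longrightarrow> of_real x + J * of_real y \<in> V"
    by (rule subdomain_half_slice_open_coords[OF ax J V D(1,3,4)]) blast
  have "V \<subseteq> \<Omega>"
    using V by (auto simp: subdomain_def dest: openin_imp_subset)
  have "\<alpha> q + J * \<beta> q = 0" if "q \<in> W" for q
  proof (cases q)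
    case (Pair x y)
    then have "of_real x + J * of_real y \<in> V"
      using W(4) that by simp
    with \<open>V \<subseteq> \<Omega>\<close> have "of_real x + J * of_real y \<in> \<Omega>" "f (of_real x + J * of_real y) = 0"
      using zero by auto
    then show ?thesis
      using comp J Pair unfolding slice_components_def by auto
  qed
  moreover have "class_C N D (\<lambda>q. \<alpha> q + J * \<beta> q)"
    by (rule class_C_add_linear[OF D(1) bounded_linear_mult_right class_C_subset[OF \<alpha> D(4)]
          class_C_subset[OF \<beta> D(4)]])
  ultimately show ?thesis
    using slice_dbar_power_identity[OF J D(1,2) _ _ W(1-3) _ p, of N "\<lambda>q. \<alpha> q + J * \<beta> q"] dbar D(4)
    by auto
qed

theorem proposition3p18:
  fixes N :: nat
    and \<Omega> U\<^sub>J U\<^sub>K :: "quaternion set"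
    and f :: "quaternion \<Rightarrow> quaternion"
    and J K :: quaternion
  assumes "N \<ge> 1"
    and "open \<Omega>" and "connected \<Omega>" and "\<Omega> \<noteq> {}"
    and "axially_symmetric \<Omega>"
    and "slice_polyanalytic N \<Omega> f"
    and "J \<in> imag_units" and "K \<in> imag_units" and "J \<noteq> K"
    and "subdomain (\<Omega> \<inter> half_slice J) U\<^sub>J"
    and "subdomain (\<Omega> \<inter> half_slice K) U\<^sub>K"
    and "\<forall>q\<in>U\<^sub>J. f q = 0" and "\<forall>q\<in>U\<^sub>K. f q = 0"
  shows "\<forall>q\<in>\<Omega>. f q = 0"
proof -
  obtain \<alpha> \<beta> where comp: "slice_components \<Omega> f \<alpha> \<beta>"
    and \<alpha>: "class_C N (slice_coords \<Omega>) \<alpha>" and \<beta>: "class_C N (slice_coords \<Omega>) \<beta>"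
    and dbar: "\<forall>I\<in>imag_units. \<forall>p\<in>slice_coords \<Omega>.
      (1 / 2 ^ N) *\<^sub>R (slice_dbar I ^^ N) (\<lambda>q. \<alpha> q + I * \<beta> q) p = 0"
    using assms(6) unfolding slice_polyanalytic_def by blast
  obtain q\<^sub>0 where "q\<^sub>0 \<in> \<Omega>" using assms(4) by blast
  \<comment> \<open>All points of \<open>\<Omega>\<close> have their half-plane coordinates in one component, so the choice of
    the base point is immaterial and the same \<open>D\<close> serves for \<open>J\<close> and \<open>K\<close>.\<close>
  define D where "D = connected_component_set (slice_coords \<Omega>) (half_plane_coords q\<^sub>0)"
  have "connected (half_plane_coords ` \<Omega>)"
    using assms(3) by (intro connected_continuous_image continuous_half_plane_coords)
  then have D: "open D" "connected D" "half_plane_coords ` \<Omega> \<subseteq> D" "D \<subseteq> slice_coords \<Omega>"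
    using \<open>q\<^sub>0 \<in> \<Omega>\<close> half_plane_coords_image_subset[OF assms(5)] open_slice_coords[OF assms(2,5,7)]
    unfolding D_def
    by (simp_all add: open_connected_component connected_component_subset connected_component_maximal)

  note slice_zero = slice_polyanalytic_slice_zero[OF assms(5) _ D comp \<alpha> \<beta>]
  have "\<alpha> p = 0 \<and> \<beta> p = 0" if "p \<in> D" for p
  proof -
    have *: "\<alpha> p + J * \<beta> p = 0" "\<alpha> p + K * \<beta> p = 0"
      using slice_zero[OF assms(7) _ assms(10,12) that] slice_zero[OF assms(8) _ assms(11,13) that]
        dbar assms(7,8) by blast+
    then have "(J - K) * \<beta> p = 0"
      by (metis add_left_cancel left_diff_distrib right_minus_eq)
    then show ?thesis using * assms(9) by simp
  qed
  moreover have "\<exists>I\<in>imag_units. \<exists>p\<in>D. f q = \<alpha> p + I * \<beta> p" if q: "q \<in> \<Omega>" for q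
  proof -
    obtain I x y where I: "I \<in> imag_units" "q = of_real x + I * of_real y"
      "half_plane_coords q = (x, y)"
      by (rule quaternion_slice_form)
    then have "(x, y) \<in> D" using q D(3) by (metis image_subset_iff)
    moreover have "f q = \<alpha> (x, y) + I * \<beta> (x, y)"
      using comp I q unfolding slice_components_def by blast
    ultimately show ?thesis using I(1) by blast
  qed
  ultimately show ?thesis by force
qed

end
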